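(* For every $0<C<2$ there exists some $\varepsilon>0$ such that the series $$\sum_{n=1}^\infty\Bigg(\sum_{k=0}^\infty\frac{d_k(n)}{e^{k^C}}\Bigg)\frac{1}{n^{\frac12+\varepsilon}}\,n^{-s}$$ does not belong to $\mathcal{H}^2$. In particular, the function $\varphi(z)=\sum_{k=0}^\infty\frac{1}{e^{k^C}}z^k$ does not define a superposition operator on $\mathcal{H}_+$.
   Context: $d_k(n)$ denotes the $n$-th Dirichlet coefficient of $\zeta^k$ ($\zeta$ the Riemann zeta function), i.e. $d_k(n)=\#\{(n_1,\dots,n_k)\in\mathbb{N}^k: n_1\cdots n_k=n\}$ for $k\ge1$, and $d_0(1)=1$, $d_0(n)=0$ for $n\ge2$. $\mathcal{H}^2$ is the space of Dirichlet series $\sum b_nn^{-s}$ with $\sum_n|b_n|^2<\infty$. $\mathcal{H}_{+}$ is the space of Dirichlet series $D=\sum a_nn^{-s}$ with $\sum_n|a_n|^2n^{-2\sigma}<\infty$ for every $\sigma>0$; such series converge absolutely for $\operatorname{Re}s>\frac12$. A power series $\varphi$ defines a superposition operator on $\mathcal{H}_+$ if it gives a function $\varphi:\mathbb{C}\to\mathbb{C}$ (i.e. it converges on all of $\mathbb{C}$) and for every $D\in\mathcal{H}_+$ the function $\varphi\circ D$ on $\{\operatorname{Re}s>\frac12\}$ is given by a Dirichlet series belonging to $\mathcal{H}_+$. *)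

theory Defs
  imports "HOL-Analysis.Analysis" "HOL-Real_Asymp.Real_Asymp"
begin

text \<open>A Dirichlet series \<open>\<Sum>\<^sub>n\<^sub>\<ge>\<^sub>1 a\<^sub>n n\<^sup>-\<^sup>s\<close> is represented by its coefficient sequence
  \<open>a :: nat \<Rightarrow> complex\<close>; the value \<open>a 0\<close> plays no role.\<close>

definition dirichlet_eval :: "(nat \<Rightarrow> complex) \<Rightarrow> complex \<Rightarrow> complex" where
  "dirichlet_eval a s = (\<Sum>n. a (Suc n) * of_nat (Suc n) powr (- s))"

definition H2 :: "(nat \<Rightarrow> complex) set" where
  "H2 = {b. summable (\<lambda>n. (cmod (b (Suc n)))\<^sup>2)}"

definition H_plus :: "(nat \<Rightarrow> complex) set" where
  "H_plus = {a. \<forall>\<sigma>>0::real. summable (\<lambda>n. (cmod (a (Suc n)))\<^sup>2 * real (Suc n) powr (- 2 * \<sigma>))}"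

definition superposition_on_H_plus :: "complex fps \<Rightarrow> bool" where
  "superposition_on_H_plus \<phi> \<longleftrightarrow>
     (\<forall>z. summable (\<lambda>k. fps_nth \<phi> k * z ^ k)) \<and>
     (\<forall>D\<in>H_plus. \<exists>E\<in>H_plus. \<forall>s. Re s > 1 / 2 \<longrightarrow>
        eval_fps \<phi> (dirichlet_eval D s) = dirichlet_eval E s)"

text \<open>The empty list has product 1, so the case \<open>k = 0\<close> gives the coefficients of the constant
  series 1.\<close>

definition divisor_d :: "nat \<Rightarrow> nat \<Rightarrow> nat" where
  "divisor_d k n = card {xs :: nat list. length xs = k \<and> (\<forall>x\<in>set xs. x \<ge> 1) \<and> prod_list xs = n}"

lemma divisor_d_0: "divisor_d 0 n = (if n = 1 then 1 else 0)"
proof -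
  have "{xs :: nat list. length xs = 0 \<and> (\<forall>x\<in>set xs. x \<ge> 1) \<and> prod_list xs = n} =
        (if n = 1 then {[]} else {})" by auto
  then show ?thesis by (simp add: divisor_d_def)
qed

lemma divisor_d_Suc:
  assumes "n \<ge> 1"
  shows "divisor_d (Suc k) n = (\<Sum>m | m dvd n. divisor_d k m)"
proof -
  let ?T = "\<lambda>k n. {xs :: nat list. length xs = k \<and> (\<forall>x\<in>set xs. x \<ge> 1) \<and> prod_list xs = n}"
  have fin: "finite (?T k n)" if "n \<ge> 1" for k n
  proof (rule finite_subset)
    show "?T k n \<subseteq> {xs. set xs \<subseteq> {..n} \<and> length xs = k}"
    proof (clarify, intro conjI subsetI)
      fix xs :: "nat list" and x
      assume "x \<in> set xs" "n = prod_list xs"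
      then have "x dvd n" by (auto dest!: split_list)
      then show "x \<in> {..prod_list xs}" using that \<open>n = prod_list xs\<close> by (auto dest: dvd_imp_le)
    qed auto
    show "finite {xs :: nat list. set xs \<subseteq> {..n} \<and> length xs = k}"
      by (rule finite_lists_length_eq) simp
  qed
  have "?T (Suc k) n = (\<Union>m\<in>{m. m dvd n}. (#) (n div m) ` ?T k m)" (is "?L = ?R")
  proof (intro equalityI subsetI)
    fix xs assume xs: "xs \<in> ?L"
    then obtain y ys where "xs = y # ys" by (cases xs) auto
    with xs assms show "xs \<in> ?R"
      by (intro UN_I[of "prod_list ys"] image_eqI[of _ _ ys]) auto
  next
    fix xs assume "xs \<in> ?R"
    then obtain m ys where "m dvd n" "ys \<in> ?T k m" "xs = n div m # ys" by auto
    moreover from this assms have "n div m \<ge> 1"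
      by (metis Suc_le_eq One_nat_def dvd_div_eq_0_iff gr0I not_one_le_zero)
    ultimately show "xs \<in> ?L" by auto
  qed
  also have "card \<dots> = (\<Sum>m | m dvd n. card ((#) (n div m) ` ?T k m))"
  proof (rule card_UN_disjoint)
    show "finite {m. m dvd n}" using assms by simp
    show "\<forall>m\<in>{m. m dvd n}. finite ((#) (n div m) ` ?T k m)"
    proof (intro ballI finite_imageI fin)
      fix m assume "m \<in> {m. m dvd n}"
      with assms show "m \<ge> 1" by (cases m) auto
    qed
  qed auto
  also have "\<dots> = (\<Sum>m | m dvd n. card (?T k m))"
    by (intro sum.cong card_image) auto
  finally show ?thesis by (simp add: divisor_d_def)
qed

lemma divisor_d_le: "n \<ge> 1 \<Longrightarrow> divisor_d k n \<le> (k + 1) ^ n"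
proof (induction k arbitrary: n)
  case 0
  then show ?case by (simp add: divisor_d_0)
next
  case (Suc k)
  have S: "{m. m dvd n} = insert n {m. m dvd n \<and> m < n}"
    using Suc.prems by (auto dest: dvd_imp_le simp: le_less)
  have fin: "finite {m. m dvd n \<and> m < n}" by simp
  have "divisor_d (Suc k) n = divisor_d k n + (\<Sum>m | m dvd n \<and> m < n. divisor_d k m)"
    using Suc.prems fin by (simp add: divisor_d_Suc S)
  also have "(\<Sum>m | m dvd n \<and> m < n. divisor_d k m) \<le> (\<Sum>m | m dvd n \<and> m < n. (k + 1) ^ (n - 1))"
  proof (rule sum_mono)
    fix m assume m: "m \<in> {m. m dvd n \<and> m < n}"
    then have "m \<ge> 1" using Suc.prems by (cases m) auto
    then have "divisor_d k m \<le> (k + 1) ^ m" by (rule Suc.IH)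
    also have "\<dots> \<le> (k + 1) ^ (n - 1)" using m by (intro power_increasing) auto
    finally show "divisor_d k m \<le> (k + 1) ^ (n - 1)" .
  qed
  also have "\<dots> \<le> n * (k + 1) ^ (n - 1)"
  proof -
    have "card {m. m dvd n \<and> m < n} \<le> card {..<n}" by (rule card_mono) auto
    then show ?thesis by simp
  qed
  also have "divisor_d k n \<le> (k + 1) ^ n" using Suc by simp
  also have "(k + 1) ^ n + n * (k + 1) ^ (n - 1) \<le> (Suc k + 1) ^ n"
  proof -
    have *: "x ^ m + m * x ^ (m - 1) \<le> (x + 1) ^ m" for x m :: nat
    proof (induction m)
      case (Suc m)
      define B where "B = m * x ^ (m - 1)"
      have "x * B = m * x ^ m" by (cases m) (auto simp: B_def algebra_simps)
      then have "x ^ Suc m + Suc m * x ^ m \<le> (x + 1) * (x ^ m + B)"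
        by (simp add: distrib_left)
      also have "\<dots> \<le> (x + 1) * (x + 1) ^ m" unfolding B_def by (intro mult_left_mono Suc) auto
      finally show ?case by simp
    qed simp
    from *[of "k + 1" n] show ?thesis by simp
  qed
  finally show ?case by simp
qed

text \<open>The inner sum over \<open>k\<close> really converges, so \<open>suminf\<close> has its intended value.\<close>

lemma summable_divisor_d_exp:
  fixes C :: real
  assumes "C > 0" "n \<ge> 1"
  shows "summable (\<lambda>k. real (divisor_d k n) / exp (real k powr C))"
proof (rule summable_comparison_test_bigo)
  show "summable (\<lambda>k. norm (real k powr (- 2)))"
    by (simp add: summable_real_powr_iff)
  have "(\<lambda>k. real (divisor_d k n) / exp (real k powr C)) \<in>
        O(\<lambda>k. (real k + 1) ^ n / exp (real k powr C))"
  proof (intro landau_o.big_mono always_eventually allI)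
    fix k
    have "real (divisor_d k n) \<le> real ((k + 1) ^ n)"
      using divisor_d_le[OF assms(2)] by (simp only: of_nat_le_iff)
    then show "norm (real (divisor_d k n) / exp (real k powr C)) \<le>
      norm ((real k + 1) ^ n / exp (real k powr C))"
      by (simp add: divide_right_mono add.commute)
  qed
  also have "(\<lambda>k. (real k + 1) ^ n / exp (real k powr C)) \<in> O(\<lambda>k. real k powr (- 2))"
    using assms by real_asymp
  finally show "(\<lambda>k. real (divisor_d k n) / exp (real k powr C)) \<in> O(\<lambda>k. real k powr (- 2))" .
qed

end

theory Submission
  imports Defs "HOL-Computational_Algebra.Squarefree"
begin

text \<open>If \<open>n\<close> is the product of the primes up to \<open>N\<close>, then \<open>d\<^sub>k(n) = k\<^bsup>\<pi>(N)\<^esup>\<close> while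
  \<open>n\<^sup>\<alpha> \<le> N\<^bsup>\<alpha>\<pi>(N)\<^esup>\<close>. With \<open>\<alpha> = 1/2 + \<epsilon>\<close> and \<open>k\<close> about \<open>3 N\<^sup>\<alpha>\<close>, the single summand \<open>k\<close> already
  makes the \<open>n\<close>-th coefficient at least \<open>exp (\<pi>(N) - k\<^sup>C)\<close>, where \<open>k\<^sup>C\<close> is of order \<open>N\<^bsup>C\<alpha>\<^esup>\<close>. Since
  \<open>C < 2\<close>, one can choose \<open>\<epsilon> > 0\<close> with \<open>C\<alpha> < 1\<close>; as \<open>\<Sum> 1/p\<close> diverges, \<open>\<pi>(N)\<close> exceeds any multiple of
  \<open>N\<^bsup>C\<alpha>\<^esup>\<close> for suitable \<open>N\<close>, so the coefficients are not even bounded.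

  For the superposition operator, take \<open>D(s) = \<zeta>(s + 1/2)\<close>, which lies in \<open>\<H>\<^sub>+\<close>. Expanding the
  powers of \<open>\<zeta>\<close> and comparing coefficients, \<open>\<phi> \<circ> D\<close> can only be the series above without the factor
  \<open>n\<^bsup>-\<epsilon>\<^esup>\<close>, and membership in \<open>\<H>\<^sub>+\<close> at \<open>\<sigma> = \<epsilon>\<close> would put the series with that factor in \<open>\<H>\<^sup>2\<close>.\<close>

section \<open>Values of \<open>divisor_d\<close> at products of distinct primes\<close>

lemma divisor_d_1 [simp]: "divisor_d k (Suc 0) = 1"
  using divisor_d_Suc[of 1] by (induction k) (simp_all add: divisor_d_0)

text \<open>The divisors of p * m are the divisors d of m together with the numbers p * d. By
  induction the second kind contributes k times as much as the first, so passing from k to k + 1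
  gives the factor 1 + k.\<close>

lemma divisor_d_prime_mult:
  assumes "prime p" "\<not> p dvd m" "m > 0"
  shows "divisor_d k (p * m) = k * divisor_d k m"
  using assms(2,3)
proof (induction k arbitrary: m)
  case 0
  have "p * m \<noteq> 1" using assms(1) by auto
  then show ?case by (simp add: divisor_d_0)
next
  case (Suc k)
  have p: "p > 0" using assms(1) by (simp add: prime_gt_0_nat)
  have split: "{d. d dvd p * m} = {d. d dvd m} \<union> (*) p ` {d. d dvd m}"
  proof (intro equalityI subsetI)
    fix d assume d: "d \<in> {d. d dvd p * m}"
    show "d \<in> {d. d dvd m} \<union> (*) p ` {d. d dvd m}"
    proof (cases "p dvd d")
      case True
      then obtain e where "d = p * e" by auto
      with d p show ?thesis by auto
    next
      case False
      then have "coprime d p" using assms(1) by (metis prime_imp_coprime coprime_commute)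
      with d show ?thesis by (simp add: coprime_dvd_mult_right_iff)
    qed
  qed auto
  have "divisor_d (Suc k) (p * m)
      = (\<Sum>d | d dvd m. divisor_d k d) + (\<Sum>d\<in>(*) p ` {d. d dvd m}. divisor_d k d)"
    using p Suc.prems unfolding split[symmetric]
    by (subst divisor_d_Suc, simp, unfold split, intro sum.union_disjoint) (auto dest: dvd_mult_left)
  also have "(\<Sum>d\<in>(*) p ` {d. d dvd m}. divisor_d k d) = (\<Sum>d | d dvd m. divisor_d k (p * d))"
    using p by (subst sum.reindex) (auto simp: inj_on_def)
  also have "\<dots> = (\<Sum>d | d dvd m. k * divisor_d k d)"
  proof (intro sum.cong refl Suc.IH)
    fix d assume d: "d \<in> {d. d dvd m}"
    then show "\<not> p dvd d" using Suc.prems by (auto dest: dvd_trans)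
    show "0 < d" using d Suc.prems by (auto intro: Nat.gr0I)
  qed
  finally show ?case
    using divisor_d_Suc[of m k] Suc.prems by (simp flip: sum_distrib_left)
qed

lemma divisor_d_prod_primes:
  assumes "finite A" "\<And>p. p \<in> A \<Longrightarrow> prime p"
  shows "divisor_d k (\<Prod>A) = k ^ card A"
  using assms
proof (induction A rule: finite_induct)
  case (insert p A)
  have "\<not> p dvd \<Prod>A"
  proof
    assume "p dvd \<Prod>A"
    then obtain q where "q \<in> A" "p dvd q"
      using insert by (auto simp: prime_dvd_prod_iff)
    with insert show False by (metis insertI1 insertI2 primes_dvd_imp_eq)
  qed
  moreover have "\<Prod>A > 0"
    using insert.prems by (intro prod_pos) (auto simp: prime_gt_0_nat)
  ultimately show ?case
    using insert by (simp add: divisor_d_prime_mult)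
qed simp

section \<open>Divergence of the prime reciprocals and lower bounds for the prime count\<close>

lemma card_multiples_le:
  fixes q x :: nat
  assumes "q > 0"
  shows "real (card {n \<in> {1..x}. q dvd n}) \<le> real x / real q"
proof -
  have "{n \<in> {1..x}. q dvd n} \<subseteq> (*) q ` {1..x div q}"
    using assms by (fastforce elim!: dvdE simp: less_eq_div_iff_mult_less_eq mult.commute)
  then have "card {n \<in> {1..x}. q dvd n} \<le> card ((*) q ` {1..x div q})"
    by (intro card_mono) auto
  also have "\<dots> \<le> x div q"
    using card_image_le[of "{1..x div q}" "(*) q"] by simp
  finally have "real (card {n \<in> {1..x}. q dvd n}) \<le> real (x div q)"
    by simp
  also have "\<dots> \<le> real x / real q" by (rule of_nat_div_le_of_nat)
  finally show ?thesis .
qed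

text \<open>Write n as its squarefree part times a square. The squarefree part is determined by its
  set of prime factors, a subset of \<open>P\<close>, and the root of the square,
  \<open>square_part n\<close>, is at most \<open>y\<close>.\<close>

lemma card_smooth_le:
  fixes P :: "nat set"
  assumes "finite P"
  shows "card {n \<in> {1..y\<^sup>2}. prime_factors n \<subseteq> P} \<le> 2 ^ card P * y"
proof -
  let ?S = "{n \<in> {1..y\<^sup>2}. prime_factors n \<subseteq> P}"
  let ?f = "\<lambda>n::nat. (prime_factors (squarefree_part n), square_part n)"
  have "inj_on ?f ?S"
  proof (rule inj_onI)
    fix m n assume "?f m = ?f n"
    then have sq: "prime_factors (squarefree_part m) = prime_factors (squarefree_part n)"
      "square_part m = square_part n" by auto
    \<comment> \<open>All multiplicities in a squarefree number are 1, so its set of primes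
      determines it; this gives injectivity.\<close>
    have "\<Prod>(prime_factors (squarefree_part k)) = squarefree_part k" for k :: nat
    proof -
      have "multiplicity p (squarefree_part k) = 1" if "p \<in> prime_factors (squarefree_part k)" for p
        using that prime_multiplicity_squarefree_part[of p k]
        by (auto simp: prime_factors_multiplicity)
      then have "\<Prod>(prime_factors (squarefree_part k))
          = (\<Prod>p\<in>prime_factors (squarefree_part k). p ^ multiplicity p (squarefree_part k))"
        by (intro prod.cong) auto
      also have "\<dots> = squarefree_part k" by (subst prod_prime_factors) auto
      finally show ?thesis .
    qed
    then show "m = n" using sq squarefree_decompose[of m] squarefree_decompose[of n] by metis
  qed
  moreover have "?f ` ?S \<subseteq> Pow P \<times> {1..y}"
  proof clarify
    fix n assume n: "n \<in> {1..y\<^sup>2}" "prime_factors n \<subseteq> P"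
    have "squarefree_part n dvd n" using squarefree_decompose[of n] by (metis dvd_triv_left)
    then have "prime_factors (squarefree_part n) \<subseteq> P"
      using n dvd_prime_factors[of n "squarefree_part n"] by auto
    moreover have "square_part n > 0" using n by (auto intro: Nat.gr0I)
    moreover have "square_part n ^ 2 \<le> n" using n by (intro dvd_imp_le) auto
    then have "square_part n ^ 2 \<le> y ^ 2" using n by (meson atLeastAtMost_iff le_trans)
    then have "square_part n \<le> y" by (simp add: power2_nat_le_eq_le)
    ultimately show "prime_factors (squarefree_part n) \<in> Pow P \<and> square_part n \<in> {1..y}"
      by auto
  qed
  ultimately have "card ?S \<le> card (Pow P \<times> {1..y})"
    using assms by (intro card_inj_on_le) auto
  then show ?thesis using assms by (simp add: card_cartesian_product card_Pow)
qed

lemma summable_Suc_powr: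
  fixes x :: real
  assumes "x > 1"
  shows "summable (\<lambda>n. real (Suc n) powr - x)"
  using assms summable_Suc_iff[of "\<lambda>n. real n powr - x"] by (simp add: summable_real_powr_iff)

text \<open>Erdos's argument: if the tail \<open>\<Sum>\<^sub>j\<^sub>\<ge>\<^sub>M 1 / p\<^sub>j\<close> were below \<open>1 / 2\<close>, then more than half of
  the integers up to \<open>y\<^sup>2\<close> would have all their prime factors among the first \<open>M\<close> primes; but
  there are at most \<open>2\<^sup>M y\<close> of those.\<close>

lemma not_summable_inverse_primes:
  "\<not> summable (\<lambda>j. 1 / real (enumerate {p::nat. prime p} j))"
proof
  define p where "p = enumerate {p::nat. prime p}"
  have inf: "infinite {p::nat. prime p}" by (rule primes_infinite)
  have prime: "prime (p j)" for j using enumerate_in_set[OF inf] by (simp add: p_def)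
  have ex: "\<exists>j. p j = q" if "prime q" for q
    using enumerate_Ex[OF inf, of q] that by (simp add: p_def)
  assume "summable (\<lambda>j. 1 / real (enumerate {p::nat. prime p} j))"
  then have sum: "summable (\<lambda>j. 1 / real (p j))" by (simp add: p_def)
  then obtain M where "norm (\<Sum>j. 1 / real (p (j + M))) < 1 / 2"
    using suminf_exist_split[of "1/2" "\<lambda>j. 1 / real (p j)"] by auto
  then have tail: "(\<Sum>j. 1 / real (p (j + M))) < 1 / 2" by simp
  \<comment> \<open>With this choice \<open>?S\<close> has at most 2^M * y = y^2 / 2 elements, while
    the sets \<open>?T j\<close> together contribute fewer than y^2 / 2.\<close>
  define y :: nat where "y = 2 ^ (M + 1)"
  have y: "y > 0" by (simp add: y_def)
  let ?S = "{n \<in> {1..y\<^sup>2}. prime_factors n \<subseteq> p ` {..<M}}"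
  let ?T = "\<lambda>j. {n \<in> {1..y\<^sup>2}. p (j + M) dvd n}"
  have "{1..y\<^sup>2} \<subseteq> ?S \<union> (\<Union>j\<in>{..y\<^sup>2}. ?T j)"
  proof
    fix n assume n: "n \<in> {1..y\<^sup>2}"
    show "n \<in> ?S \<union> (\<Union>j\<in>{..y\<^sup>2}. ?T j)"
    proof (cases "prime_factors n \<subseteq> p ` {..<M}")
      case False
      then obtain q where q: "prime q" "q dvd n" "q \<notin> p ` {..<M}" by auto
      obtain j where j: "p j = q" using ex q by auto
      with q have "j \<ge> M" by (auto simp: not_less[symmetric])
      then obtain i where i: "j = i + M" using le_Suc_ex by (metis add.commute)
      \<comment> \<open>The enumeration satisfies j <= p j, so i <= q <= y^2 and finitely many sets
        \<open>?T\<close> suffice.\<close>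
      have "i \<le> q" using le_enumerate[OF inf, of j] i j by (simp add: p_def)
      also have "q \<le> y\<^sup>2" using dvd_imp_le[OF q(2)] n by simp
      finally show ?thesis using n q i j by auto
    qed (use n in auto)
  qed
  then have "card {1..y\<^sup>2} \<le> card (?S \<union> (\<Union>j\<in>{..y\<^sup>2}. ?T j))"
    by (intro card_mono) auto
  also have "\<dots> \<le> card ?S + (\<Sum>j\<le>y\<^sup>2. card (?T j))"
    by (intro order.trans[OF card_Un_le] add_left_mono card_UN_le) auto
  finally have "real y ^ 2 \<le> real (card ?S) + (\<Sum>j\<le>y\<^sup>2. real (card (?T j)))"
    by (simp flip: of_nat_power of_nat_sum of_nat_add)
  also have "card ?S \<le> 2 ^ card (p ` {..<M}) * y" by (rule card_smooth_le) simp
  also have "\<dots> \<le> 2 ^ M * y"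
    using card_image_le[of "{..<M}" p] by (intro mult_right_mono power_increasing) auto
  also have "(\<Sum>j\<le>y\<^sup>2. real (card (?T j))) \<le> (\<Sum>j\<le>y\<^sup>2. real (y\<^sup>2) / real (p (j + M)))"
    by (intro sum_mono card_multiples_le prime_gt_0_nat prime)
  also have "\<dots> = real y ^ 2 * (\<Sum>j\<le>y\<^sup>2. 1 / real (p (j + M)))"
    by (simp add: sum_distrib_left)
  also have "(\<Sum>j\<le>y\<^sup>2. 1 / real (p (j + M))) \<le> (\<Sum>j. 1 / real (p (j + M)))"
    using summable_ignore_initial_segment[OF sum] by (intro sum_le_suminf) auto
  also note tail
  finally show False
    using y by (simp add: y_def power2_eq_square)
qed

text \<open>Otherwise the case N = \<open>p j\<close>, where at least j + 1 primes are counted,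
  gives j + 1 <= A * (p j)^\<theta>. Then 1 / p j is at most a constant times (j + 1)^(-1/\<theta>),
  and since 1/\<theta> > 1 the prime reciprocals would be summable.\<close>

lemma prime_count_ge_powr:
  fixes A \<theta> :: real
  assumes "A > 0" "0 < \<theta>" "\<theta> < 1"
  shows "\<exists>N\<ge>1. A * real N powr \<theta> \<le> real (card {p::nat. prime p \<and> p \<le> N})"
proof (rule ccontr)
  define p where "p = enumerate {p::nat. prime p}"
  have inf: "infinite {p::nat. prime p}" by (rule primes_infinite)
  have prime: "prime (p j)" for j using enumerate_in_set[OF inf] by (simp add: p_def)
  assume neg: "\<not> ?thesis"
  then have less: "real (card {p::nat. prime p \<and> p \<le> N}) < A * real N powr \<theta>" if "N \<ge> 1" for N
    using that neg by (meson not_le)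
  have bound: "1 / real (p j) \<le> A powr (1 / \<theta>) * real (Suc j) powr - (1 / \<theta>)" for j
  proof -
    have pos: "p j \<ge> 1" using prime_gt_0_nat[OF prime, of j] by simp
    have "p ` {..j} \<subseteq> {q. prime q \<and> q \<le> p j}"
      using prime inf by (auto simp: p_def)
    then have "card (p ` {..j}) \<le> card {q. prime q \<and> q \<le> p j}"
      by (intro card_mono) auto
    moreover have "card (p ` {..j}) = Suc j"
      unfolding p_def by (subst card_image) (auto intro: inj_on_subset[OF inj_enumerate[OF inf]])
    ultimately have "real (Suc j) \<le> A * real (p j) powr \<theta>" using less[OF pos] by linarith
    then have "real (Suc j) powr (1 / \<theta>) \<le> (A * real (p j) powr \<theta>) powr (1 / \<theta>)"
      using assms by (intro powr_mono2) auto
    also have "\<dots> = A powr (1 / \<theta>) * real (p j)"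
      using assms pos by (simp add: powr_mult powr_powr)
    finally show ?thesis using pos by (simp add: powr_minus field_simps)
  qed
  have "summable (\<lambda>j. A powr (1 / \<theta>) * real (Suc j) powr - (1 / \<theta>))"
    using assms by (intro summable_mult summable_Suc_powr) simp
  then have "summable (\<lambda>j. 1 / real (p j))"
    by (rule summable_comparison_test'[where N = 0]) (use bound in simp)
  then show False using not_summable_inverse_primes by (simp add: p_def)
qed

section \<open>Dirichlet products and power series in the zeta function\<close>

text \<open>Nonnegativity turns the iterated sum into an unconditional sum over pairs (m, l), which
  can be regrouped by the product n = m * l; for fixed n only the finitely many divisors m of n
  remain.\<close>

lemma has_sum_dirichlet_prod:
  fixes f g :: "nat \<Rightarrow> real"
  assumes f: "(f has_sum a) {1..}" and g: "(g has_sum b) {1..}"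
    and nonneg: "\<And>n. f n \<ge> 0" "\<And>n. g n \<ge> 0"
  shows "((\<lambda>n. \<Sum>m | m dvd n. f m * g (n div m)) has_sum (a * b)) {1..}"
proof -
  have row: "((\<lambda>l. f m * g l) has_sum (f m * b)) {1..}" for m
    using g by (rule has_sum_cmult_right)
  have col: "((\<lambda>m. f m * b) has_sum (a * b)) {1..}"
    using f by (rule has_sum_cmult_left)
  have "(\<lambda>(m, l). f m * g l) summable_on {1..} \<times> {1..}"
    by (rule summable_on_SigmaI[where g = "\<lambda>m. f m * b"])
      (use row col nonneg in \<open>auto intro: has_sum_imp_summable\<close>)
  then have "((\<lambda>(m, l). f m * g l) has_sum (a * b)) ({1..} \<times> {1..})"
    by (intro has_sum_SigmaI[where g = "\<lambda>m. f m * b"]) (use row col in auto)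
  also have "?this \<longleftrightarrow> ((\<lambda>(n, m). f m * g (n div m)) has_sum (a * b)) (SIGMA n:{1..}. {m. m dvd n})"
    by (rule has_sum_reindex_bij_witness[where j = "\<lambda>(m, l). (m * l, m)" and i = "\<lambda>(n, m). (m, n div m)"])
      (auto simp: Suc_le_eq elim!: dvdE intro: Nat.gr0I)
  finally show ?thesis
    by (rule has_sum_SigmaD) (auto intro!: has_sum_finiteI)
qed

text \<open>With Z = zeta(x), this is the expansion of zeta(x)^k: by \<open>divisor_d_Suc\<close>,
  raising k by one is Dirichlet convolution with the constant sequence 1.\<close>

lemma has_sum_divisor_d:
  assumes "((\<lambda>n. real n powr - x) has_sum Z) {1..}"
  shows "((\<lambda>n. real (divisor_d k n) * real n powr - x) has_sum (Z ^ k)) {1..}"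
proof (induction k)
  case 0
  have "((\<lambda>n. real (divisor_d 0 n) * real n powr - x) has_sum 1) {1}"
    by (rule has_sum_finiteI) (auto simp: divisor_d_0)
  also have "?this \<longleftrightarrow> ((\<lambda>n. real (divisor_d 0 n) * real n powr - x) has_sum 1) {1..}"
    by (rule has_sum_cong_neutral) (auto simp: divisor_d_0)
  finally show ?case by simp
next
  case (Suc k)
  have eq: "(\<Sum>m | m dvd n. real (divisor_d k m) * real m powr - x * real (n div m) powr - x)
      = real (divisor_d (Suc k) n) * real n powr - x" if "n \<in> {1..}" for n
  proof -
    have "real m powr - x * real (n div m) powr - x = real n powr - x" if "m dvd n" for m
      using that by (auto simp flip: powr_mult of_nat_mult)
    then show ?thesis
      using that by (simp add: divisor_d_Suc sum_distrib_right mult.assoc)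
  qed
  have "((\<lambda>n. \<Sum>m | m dvd n. real (divisor_d k m) * real m powr - x * real (n div m) powr - x)
      has_sum (Z ^ k * Z)) {1..}"
    by (rule has_sum_dirichlet_prod[OF Suc.IH assms]) auto
  then show ?case
    by (subst (asm) has_sum_cong[OF eq]) (simp_all add: mult.commute)
qed

text \<open>All terms are nonnegative, so after expanding each power Z^k the sums over k and n may
  be interchanged. Assumption \<open>d\<close> makes each inner \<open>suminf\<close> a genuine
  sum.\<close>

lemma has_sum_power_series_divisor_d:
  fixes c :: "nat \<Rightarrow> real"
  assumes Z: "((\<lambda>n. real n powr - x) has_sum Z) {1..}"
    and c: "\<And>k. c k \<ge> 0" "summable (\<lambda>k. c k * Z ^ k)"
    and d: "\<And>n. n \<ge> 1 \<Longrightarrow> summable (\<lambda>k. c k * real (divisor_d k n))"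
  shows "((\<lambda>n. (\<Sum>k. c k * real (divisor_d k n)) * real n powr - x) has_sum (\<Sum>k. c k * Z ^ k)) {1..}"
proof -
  let ?h = "\<lambda>(k, n). c k * (real (divisor_d k n) * real n powr - x)"
  have Z0: "Z \<ge> 0" using Z by (rule has_sum_nonneg) auto
  have row: "((\<lambda>n. c k * (real (divisor_d k n) * real n powr - x)) has_sum (c k * Z ^ k)) {1..}" for k
    by (intro has_sum_cmult_right has_sum_divisor_d Z)
  have col: "((\<lambda>k. c k * Z ^ k) has_sum (\<Sum>k. c k * Z ^ k)) UNIV"
    using c Z0 by (intro sums_nonneg_imp_has_sum summable_sums) auto
  have "?h summable_on UNIV \<times> {1..}"
    by (rule summable_on_SigmaI[where g = "\<lambda>k. c k * Z ^ k"])
      (use row col c in \<open>auto intro: has_sum_imp_summable\<close>)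
  then have "(?h has_sum (\<Sum>k. c k * Z ^ k)) (UNIV \<times> {1..})"
    by (intro has_sum_SigmaI[where g = "\<lambda>k. c k * Z ^ k"]) (use row col in auto)
  then have "((\<lambda>(n, k). ?h (k, n)) has_sum (\<Sum>k. c k * Z ^ k)) ({1..} \<times> UNIV)"
    by (subst (asm) has_sum_swap)
  then show ?thesis
  proof (rule has_sum_SigmaD)
    fix n :: nat assume "n \<in> {1..}"
    then have "(\<lambda>k. c k * real (divisor_d k n)) sums (\<Sum>k. c k * real (divisor_d k n))"
      by (intro summable_sums d) simp
    then have "((\<lambda>k. c k * real (divisor_d k n)) has_sum (\<Sum>k. c k * real (divisor_d k n))) UNIV"
      using c by (intro sums_nonneg_imp_has_sum) auto
    from has_sum_cmult_left[OF this, of "real n powr - x"]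
    show "((\<lambda>k. case (n, k) of (n, k) \<Rightarrow> ?h (k, n)) has_sum
        (\<Sum>k. c k * real (divisor_d k n)) * real n powr - x) UNIV"
      by (simp add: mult.assoc)
  qed
qed

section \<open>Uniqueness of Dirichlet coefficients\<close>

text \<open>By strong induction all earlier coefficients vanish. At exponent \<sigma> + t the tail
  after base n + 1 is O((n + 2)^(-t)), so the coefficient is bounded by a constant times ((n + 1) /
  (n + 2))^t, which tends to 0 as t grows.\<close>

lemma dirichlet_coeffs_zero:
  fixes f :: "nat \<Rightarrow> complex"
  assumes abs: "summable (\<lambda>n. cmod (f (Suc n)) * real (Suc n) powr - \<sigma>)"
    and zero: "\<And>s::real. s \<ge> \<sigma> \<Longrightarrow> (\<Sum>n. f (Suc n) * of_real (real (Suc n) powr - s)) = 0"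
  shows "f (Suc n) = 0"
proof (induction n rule: less_induct)
  case (less n)
  define B where "B = (\<Sum>m. cmod (f (Suc m)) * real (Suc m) powr - \<sigma>)"
  have bound: "cmod (f (Suc n)) \<le> real (Suc n) powr \<sigma> * B * (real (Suc n) / real (n + 2)) powr t"
    if t: "t \<ge> 0" for t
  proof -
    let ?g = "\<lambda>m. f (Suc m) * of_real (real (Suc m) powr - (\<sigma> + t))"
    \<comment> \<open>The tail begins at base n + 2; bounding the factor with exponent -t there
      leaves the terms of the series that converges absolutely at \<sigma>.\<close>
    have le: "cmod (?g (m + Suc n)) \<le> cmod (f (Suc (m + Suc n))) * real (Suc (m + Suc n)) powr - \<sigma> * real (n + 2) powr - t" for m
    proof -
      have "real (Suc (m + Suc n)) powr - t \<le> real (n + 2) powr - t"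
        using t by (intro powr_mono2') auto
      then have "cmod (f (Suc (m + Suc n))) * (real (Suc (m + Suc n)) powr - \<sigma> * real (Suc (m + Suc n)) powr - t)
          \<le> cmod (f (Suc (m + Suc n))) * (real (Suc (m + Suc n)) powr - \<sigma> * real (n + 2) powr - t)"
        by (intro mult_left_mono) auto
      then show ?thesis
        by (simp add: norm_mult mult.assoc flip: powr_add)
    qed
    have tail: "summable (\<lambda>m. cmod (f (Suc (m + Suc n))) * real (Suc (m + Suc n)) powr - \<sigma>)"
      using summable_ignore_initial_segment[OF abs, of "Suc n"] .
    have sg: "summable (\<lambda>m. cmod (?g (m + Suc n)))"
      by (rule summable_comparison_test'[OF summable_mult2[OF tail, of "real (n + 2) powr - t"], of 0])
        (use le in simp)
    then have "summable (\<lambda>m. ?g (m + Suc n))" by (rule summable_norm_cancel)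
    then have "summable ?g" by (subst (asm) summable_iff_shift)
    then have "(\<Sum>m. ?g (m + Suc n)) + (\<Sum>m<Suc n. ?g m) = (\<Sum>m. ?g m)"
      by (simp only: suminf_split_initial_segment[of ?g "Suc n"])
    also have "\<dots> = 0" by (rule zero) (use t in simp)
    also have "(\<Sum>m<Suc n. ?g m) = ?g n" using less by simp
    finally have "?g n = - (\<Sum>m. ?g (m + Suc n))" by (simp only: eq_neg_iff_add_eq_0 add.commute)
    then have "cmod (?g n) = cmod (\<Sum>m. ?g (m + Suc n))" by (simp only: norm_minus_cancel)
    also have "\<dots> \<le> (\<Sum>m. cmod (?g (m + Suc n)))" by (rule summable_norm[OF sg])
    also have "\<dots> \<le> (\<Sum>m. cmod (f (Suc (m + Suc n))) * real (Suc (m + Suc n)) powr - \<sigma> * real (n + 2) powr - t)"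
      by (intro suminf_le le sg summable_mult2 tail)
    also have "\<dots> = (\<Sum>m. cmod (f (Suc (m + Suc n))) * real (Suc (m + Suc n)) powr - \<sigma>) * real (n + 2) powr - t"
      by (rule suminf_mult2[OF tail, symmetric])
    also have "\<dots> \<le> B * real (n + 2) powr - t"
      unfolding B_def
      by (subst suminf_split_initial_segment[OF abs, of "Suc n"])
        (intro mult_right_mono, auto intro!: sum_nonneg simp del: sum.lessThan_Suc)
    finally have "cmod (f (Suc n)) * real (Suc n) powr - (\<sigma> + t) \<le> B * real (n + 2) powr - t"
      by (simp add: norm_mult)
    from mult_right_mono[OF this, of "real (Suc n) powr (\<sigma> + t)"]
    have "cmod (f (Suc n)) \<le> B * real (n + 2) powr - t * real (Suc n) powr (\<sigma> + t)"
      by (simp add: mult.assoc del: of_nat_Suc of_nat_add flip: powr_add)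
    also have "\<dots> = real (Suc n) powr \<sigma> * B * (real (Suc n) / real (n + 2)) powr t"
      by (simp add: powr_add powr_divide powr_minus_divide mult_ac del: of_nat_Suc of_nat_add)
    finally show ?thesis .
  qed
  have "((\<lambda>t. real (Suc n) powr \<sigma> * B * (real (Suc n) / real (n + 2)) powr t) \<longlongrightarrow> real (Suc n) powr \<sigma> * B * 0) at_top"
    by (intro tendsto_mult_left) real_asymp
  then have "cmod (f (Suc n)) \<le> real (Suc n) powr \<sigma> * B * 0"
    by (rule tendsto_lowerbound) (use bound in \<open>auto intro: eventually_mono[OF eventually_ge_at_top[of 0]]\<close>)
  then show ?case by simp
qed

section \<open>Unboundedness of the coefficients\<close>

lemma divisor_series_unbounded:
  fixes C \<alpha> K :: real
  assumes C: "C > 0" and \<alpha>: "\<alpha> > 0" "C * \<alpha> < 1"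
  shows "\<exists>n\<ge>1. K < (\<Sum>k. real (divisor_d k n) / exp (real k powr C)) * (1 / real n powr \<alpha>)"
proof -
  \<comment> \<open>Truncation at 0 ensures that B <= B * N^(C * \<alpha>).\<close>
  define B where "B = max K 0"
  have "4 powr C + B > 0" by (simp add: B_def add_pos_nonneg)
  \<comment> \<open>The summand 4^C of the constant pays for k^C below; \<open>B\<close> leaves a
    surplus of at least K in the exponent.\<close>
  then obtain N where N: "N \<ge> 1"
    and count: "(4 powr C + B) * real N powr (C * \<alpha>) \<le> real (card {p. prime p \<and> p \<le> N})"
    using prime_count_ge_powr[of "4 powr C + B" "C * \<alpha>"] assms by auto
  define A where "A = {p. prime p \<and> p \<le> N}"
  have A: "finite A" "\<And>p. p \<in> A \<Longrightarrow> prime p" by (auto simp: A_def)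
  define n where "n = \<Prod>A"
  have "n > 0" unfolding n_def using A by (intro prod_pos) (auto simp: prime_gt_0_nat)
  define x where "x = real N powr \<alpha>"
  have x: "x \<ge> 1" using N \<alpha> by (simp add: x_def ge_one_powr_ge_zero)
  \<comment> \<open>Since e <= 3, k / x is at least e, so each prime in \<open>A\<close> contributes
    a factor of at least e. Because x >= 1, rounding up keeps k below or at 4 * x.\<close>
  define k where "k = nat \<lceil>3 * x\<rceil>"
  have k: "3 * x \<le> real k" "real k \<le> 4 * x" using x unfolding k_def by linarith+
  have "real k powr C \<le> (4 * x) powr C" using k C by (intro powr_mono2) auto
  also have "\<dots> = 4 powr C * real N powr (C * \<alpha>)"
    using x by (simp add: powr_mult x_def powr_powr mult.commute)
  finally have "real k powr C + B * real N powr (C * \<alpha>) \<le> real (card A)"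
    using count by (simp add: A_def distrib_right)
  moreover have "B * 1 \<le> B * real N powr (C * \<alpha>)"
    using N assms by (intro mult_left_mono ge_one_powr_ge_zero) (auto simp: B_def)
  ultimately have kC: "K \<le> real (card A) - real k powr C" by (simp add: B_def)
  have "n \<le> N ^ card A"
    using prod_mono[of A "\<lambda>p. p" "\<lambda>_. N"] by (simp add: n_def A_def)
  then have "real n powr \<alpha> \<le> (real N ^ card A) powr \<alpha>"
    using \<alpha> by (intro powr_mono2) (auto simp flip: of_nat_power)
  also have "\<dots> = (real N powr real (card A)) powr \<alpha>"
    using N by (subst powr_realpow) auto
  also have "\<dots> = x powr real (card A)"
    by (simp only: x_def powr_powr mult.commute)
  also have "\<dots> = x ^ card A"
    using x by (intro powr_realpow) auto
  finally have n_le: "real n powr \<alpha> \<le> x ^ card A" .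
  have "K < exp K" using exp_ge_add_one_self[of K] by linarith
  also have "\<dots> \<le> exp (real (card A)) / exp (real k powr C)"
    using kC by (simp flip: exp_diff)
  also have "exp (real (card A)) = exp 1 ^ card A" by (simp flip: exp_of_nat_mult)
  also have "\<dots> \<le> (real k / x) ^ card A"
  proof (intro power_mono)
    have "exp 1 * x \<le> 3 * x" using x exp_le by (intro mult_right_mono) auto
    then have "exp 1 * x \<le> real k" using k by linarith
    then show "exp 1 \<le> real k / x" using x by (simp add: field_simps)
  qed simp
  also have "\<dots> = real (divisor_d k n) / x ^ card A"
    by (simp add: n_def divisor_d_prod_primes[OF A] power_divide)
  also have "\<dots> \<le> real (divisor_d k n) / real n powr \<alpha>"
    using n_le x \<open>n > 0\<close> by (intro divide_left_mono) auto
  finally have "K < real (divisor_d k n) / exp (real k powr C) * (1 / real n powr \<alpha>)"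
    by (simp add: field_simps divide_right_mono)
  \<comment> \<open>A single term bounds the sum from below, as all terms are nonnegative.\<close>
  also have "real (divisor_d k n) / exp (real k powr C) \<le> (\<Sum>k. real (divisor_d k n) / exp (real k powr C))"
    using sum_le_suminf[OF summable_divisor_d_exp[of C n], of "{k}"] C \<open>n > 0\<close> by simp
  finally show ?thesis using \<open>n > 0\<close> by (intro exI[of _ n]) (auto simp: divide_right_mono)
qed

lemma bounded_if_square_summable:
  fixes a :: "nat \<Rightarrow> real"
  assumes "summable (\<lambda>n. (a n)\<^sup>2)"
  shows "\<exists>K. \<forall>n. \<bar>a n\<bar> \<le> K"
proof -
  have "Bseq (\<lambda>n. (a n)\<^sup>2)"
    using assms by (intro convergent_imp_Bseq summable_imp_convergent)
  then obtain B where B: "\<And>n. (a n)\<^sup>2 \<le> B" by (auto simp: Bseq_def)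
  then have "\<bar>a n\<bar> \<le> sqrt B" for n
    using real_sqrt_le_mono[OF B[of n]] by simp
  then show ?thesis by blast
qed

text \<open>Square-summable coefficients are bounded, which \<open>divisor_series_unbounded\<close>
  excludes.\<close>

lemma divisor_series_not_H2:
  fixes C \<alpha> :: real
  assumes "C > 0" "\<alpha> > 0" "C * \<alpha> < 1"
  shows "(\<lambda>n. complex_of_real ((\<Sum>k. real (divisor_d k n) / exp (real k powr C))
           * (1 / real n powr \<alpha>))) \<notin> H2" (is "(\<lambda>n. complex_of_real (?a n)) \<notin> H2")
proof
  assume "(\<lambda>n. complex_of_real (?a n)) \<in> H2"
  then have "summable (\<lambda>n. (?a (Suc n))\<^sup>2)" 
    by (simp only: H2_def mem_Collect_eq norm_of_real power2_abs)
  from bounded_if_square_summable[OF this]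
  obtain K where K: "\<And>n. \<bar>?a (Suc n)\<bar> \<le> K" by blast
  obtain n where n: "n \<ge> 1" "K < ?a n" using divisor_series_unbounded[OF assms] by blast
  have "?a n \<le> K" using abs_le_D1[OF K[of "n - 1"]] n(1) by simp
  with n(2) show False by simp
qed

section \<open>Composition with the shifted zeta function\<close>

lemma dirichlet_eval_real:
  "dirichlet_eval a (of_real s) = (\<Sum>n. a (Suc n) * of_real (real (Suc n) powr - s))"
proof -
  have "of_nat (Suc n) powr (- complex_of_real s) = of_real (real (Suc n) powr - s)" for n
    using powr_of_real[of "real (Suc n)" "- s"] by (simp del: of_nat_Suc)
  then show ?thesis by (simp add: dirichlet_eval_def)
qed

lemma has_sum_Suc_iff:
  fixes f :: "nat \<Rightarrow> 'a :: {comm_monoid_add, topological_space}"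
  shows "((\<lambda>n. f (Suc n)) has_sum S) UNIV \<longleftrightarrow> (f has_sum S) {1..}"
  by (rule has_sum_reindex_bij_witness[where j = Suc and i = "\<lambda>n. n - 1"]) auto

text \<open>\<open>D\<close> is the coefficient sequence of zeta(s + 1/2), so at real s > 1/2 it
  evaluates to the real number Z = zeta(x) with x = s + 1/2. Convergence of the power series at Z
  allows \<open>has_sum_power_series_divisor_d\<close> to be applied, and n^(-x) splits into
  n^(-1/2) and n^(-s).\<close>

lemma dirichlet_eval_power_series:
  fixes c :: "nat \<Rightarrow> real" and s :: real
  defines "D \<equiv> \<lambda>n. complex_of_real (real n powr - (1 / 2))"
  assumes s: "s > 1 / 2" and c: "\<And>k. c k \<ge> 0"
    and entire: "\<And>z. summable (\<lambda>k. complex_of_real (c k) * z ^ k)"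
    and d: "\<And>n. n \<ge> 1 \<Longrightarrow> summable (\<lambda>k. c k * real (divisor_d k n))"
  shows "eval_fps (Abs_fps (\<lambda>k. complex_of_real (c k))) (dirichlet_eval D (of_real s))
     = (\<Sum>n. of_real ((\<Sum>k. c k * real (divisor_d k (Suc n))) * real (Suc n) powr - (1 / 2)
          * real (Suc n) powr - s))"
    and "summable (\<lambda>n. (\<Sum>k. c k * real (divisor_d k (Suc n))) * real (Suc n) powr - (1 / 2)
          * real (Suc n) powr - s)"
proof -
  define x where "x = s + 1 / 2"
  define Z where "Z = (\<Sum>n. real (Suc n) powr - x)"
  have x: "real n powr - (1 / 2) * real n powr - s = real n powr - x" for n
    by (simp add: x_def algebra_simps flip: powr_add)
  have "summable (\<lambda>n. real (Suc n) powr - x)"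
    using s by (intro summable_Suc_powr) (simp add: x_def)
  then have sums: "(\<lambda>n. real (Suc n) powr - x) sums Z" unfolding Z_def by (rule summable_sums)
  then have "((\<lambda>n. real (Suc n) powr - x) has_sum Z) UNIV"
    by (intro sums_nonneg_imp_has_sum) auto
  then have Z: "((\<lambda>n. real n powr - x) has_sum Z) {1..}" by (subst (asm) has_sum_Suc_iff)
  have "dirichlet_eval D (of_real s) = (\<Sum>n. of_real (real (Suc n) powr - x))"
    by (simp only: dirichlet_eval_real D_def x flip: of_real_mult)
  also have "\<dots> = of_real Z" using sums_of_real[OF sums] by (rule sums_unique[symmetric])
  finally have eval_D: "dirichlet_eval D (of_real s) = of_real Z" .
  have cZ: "summable (\<lambda>k. c k * Z ^ k)"
    using entire[of "of_real Z"] by (simp flip: of_real_power of_real_mult add: summable_of_real_iff)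
  have "((\<lambda>n. (\<Sum>k. c k * real (divisor_d k n)) * real n powr - x) has_sum (\<Sum>k. c k * Z ^ k)) {1..}"
    by (rule has_sum_power_series_divisor_d[OF Z c cZ d])
  then have "(\<lambda>n. (\<Sum>k. c k * real (divisor_d k (Suc n))) * real (Suc n) powr - x) sums (\<Sum>k. c k * Z ^ k)"
    by (intro has_sum_imp_sums) (subst has_sum_Suc_iff)
  then have sums': "(\<lambda>n. (\<Sum>k. c k * real (divisor_d k (Suc n))) * real (Suc n) powr - (1 / 2)
          * real (Suc n) powr - s) sums (\<Sum>k. c k * Z ^ k)"
    by (simp only: mult.assoc x)
  then show "summable (\<lambda>n. (\<Sum>k. c k * real (divisor_d k (Suc n))) * real (Suc n) powr - (1 / 2)
          * real (Suc n) powr - s)" by (rule sums_summable)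
  have "eval_fps (Abs_fps (\<lambda>k. complex_of_real (c k))) (of_real Z) = of_real (\<Sum>k. c k * Z ^ k)"
    using suminf_of_real[OF cZ, where 'a = complex] by (simp add: eval_fps_def)
  also have "\<dots> = (\<Sum>n. of_real ((\<Sum>k. c k * real (divisor_d k (Suc n))) * real (Suc n) powr - (1 / 2)
          * real (Suc n) powr - s))"
    using sums_of_real[OF sums'] by (rule sums_unique)
  finally show "eval_fps (Abs_fps (\<lambda>k. complex_of_real (c k))) (dirichlet_eval D (of_real s))
     = (\<Sum>n. of_real ((\<Sum>k. c k * real (divisor_d k (Suc n))) * real (Suc n) powr - (1 / 2)
          * real (Suc n) powr - s))"
    by (simp only: eval_D)
qed

text \<open>By 2 * t <= t^2 + 1 the series is dominated by the case \<sigma> = 1 of membership plus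
  the sum of n^(-2). \<open>dirichlet_coeffs_zero\<close> asks for just one exponent of absolute
  convergence, so the crude value 2 suffices.\<close>

lemma H_plus_abs_summable:
  assumes "E \<in> H_plus"
  shows "summable (\<lambda>n. cmod (E (Suc n)) * real (Suc n) powr - 2)"
proof -
  have 1: "summable (\<lambda>n. (cmod (E (Suc n)))\<^sup>2 * real (Suc n) powr - 2)"
    using assms by (auto simp: H_plus_def dest: spec[of _ 1])
  have 2: "summable (\<lambda>n. real (Suc n) powr - 2)"
    by (rule summable_Suc_powr) simp
  show ?thesis
  proof (rule summable_comparison_test'[OF summable_add[OF 1 2], of 0])
    fix n
    have "2 * cmod (E (Suc n)) \<le> (cmod (E (Suc n)))\<^sup>2 + 1"
      using zero_le_power2[of "cmod (E (Suc n)) - 1"] by (simp add: power2_diff)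
    then have "cmod (E (Suc n)) \<le> (cmod (E (Suc n)))\<^sup>2 + 1"
      using norm_ge_zero[of "E (Suc n)"] by linarith
    from mult_right_mono[OF this, of "real (Suc n) powr - 2"]
    show "norm (cmod (E (Suc n)) * real (Suc n) powr - 2)
      \<le> (cmod (E (Suc n)))\<^sup>2 * real (Suc n) powr - 2 + real (Suc n) powr - 2"
      by (simp add: distrib_right)
  qed
qed

text \<open>The weighted squares are n^(-(1 + 2 * \<sigma>)), summable for every \<sigma> >
  0.\<close>

lemma zeta_shift_in_H_plus: "(\<lambda>n. complex_of_real (real n powr - (1 / 2))) \<in> H_plus"
proof -
  have "summable (\<lambda>n. (real (Suc n) powr - (1 / 2))\<^sup>2 * real (Suc n) powr (- 2 * \<sigma>))"
    if "\<sigma> > 0" for \<sigma> :: real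
  proof -
    have "(real n powr - (1 / 2))\<^sup>2 * real n powr (- 2 * \<sigma>) = real n powr - (1 + 2 * \<sigma>)" for n
    proof -
      have "- (1 / 2) + - (1 / 2) + - 2 * \<sigma> = - (1 + 2 * \<sigma>)" by simp
      then show ?thesis by (simp only: power2_eq_square flip: powr_add)
    qed
    then show ?thesis
      using summable_Suc_powr[of "1 + 2 * \<sigma>"] that by (simp del: of_nat_Suc)
  qed
  then show ?thesis by (simp add: H_plus_def del: of_nat_Suc)
qed

theorem proposition5p10:
  fixes C :: real
  assumes "0 < C" and "C < 2"
  shows "(\<exists>\<epsilon>>0::real.
            (\<lambda>n. complex_of_real ((\<Sum>k. real (divisor_d k n) / exp (real k powr C))
                    * (1 / real n powr (1 / 2 + \<epsilon>)))) \<notin> H2)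
       \<and> \<not> superposition_on_H_plus (Abs_fps (\<lambda>k. complex_of_real (1 / exp (real k powr C))))"
proof -
  \<comment> \<open>Half of the room left by C < 2: this value gives C * (1/2 + \<epsilon>) = 1/2 +
    C / 4 < 1.\<close>
  define \<epsilon> where "\<epsilon> = (1 / C - 1 / 2) / 2"
  have \<epsilon>: "\<epsilon> > 0" "C * (1 / 2 + \<epsilon>) < 1"
    using assms by (auto simp: \<epsilon>_def field_simps)
  define b where "b = (\<lambda>n. \<Sum>k. real (divisor_d k n) / exp (real k powr C))"
  have not_H2: "(\<lambda>n. complex_of_real (b n * (1 / real n powr (1 / 2 + \<epsilon>)))) \<notin> H2"
    unfolding b_def using assms \<epsilon> by (intro divisor_series_not_H2) auto
  define c where "c = (\<lambda>k. 1 / exp (real k powr C))"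
  have b: "b n = (\<Sum>k. c k * real (divisor_d k n))" for n by (simp add: b_def c_def)
  have "\<not> superposition_on_H_plus (Abs_fps (\<lambda>k. complex_of_real (c k)))"
  proof
    let ?\<phi> = "Abs_fps (\<lambda>k. complex_of_real (c k))"
    let ?D = "\<lambda>n. complex_of_real (real n powr - (1 / 2))"
    assume sup: "superposition_on_H_plus ?\<phi>"
    then have entire: "\<And>z. summable (\<lambda>k. complex_of_real (c k) * z ^ k)"
      by (simp add: superposition_on_H_plus_def)
    obtain E where E: "E \<in> H_plus"
      and eval: "\<And>s. Re s > 1 / 2 \<Longrightarrow> eval_fps ?\<phi> (dirichlet_eval ?D s) = dirichlet_eval E s"
      using sup zeta_shift_in_H_plus unfolding superposition_on_H_plus_def by blast
    have d: "summable (\<lambda>k. c k * real (divisor_d k n))" if "n \<ge> 1" for n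
      using summable_divisor_d_exp[OF assms(1) that] by (simp add: c_def)
    note series = dirichlet_eval_power_series[of _ c, OF _ _ entire d, folded b]
    \<comment> \<open>These are the coefficients that the expansion yields for the composite with
      zeta(s + 1/2).\<close>
    define a where "a = (\<lambda>n. b n * real n powr - (1 / 2))"
    have b0: "b n \<ge> 0" if "n \<ge> 1" for n
      unfolding b by (rule suminf_nonneg[OF d[OF that]]) (simp add: c_def)
    have sum_a: "summable (\<lambda>n. a (Suc n) * real (Suc n) powr - s)" if "s > 1 / 2" for s :: real
      unfolding a_def using that by (intro series) (auto simp: c_def)
    have E_summable: "summable (\<lambda>n. cmod (E (Suc n)) * real (Suc n) powr - 2)"
      by (rule H_plus_abs_summable[OF E])
    \<comment> \<open>Both series have the same values at all real s >= 2 and converge absolutely at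
      2, so uniqueness applies to their difference.\<close>
    have "E (Suc n) - of_real (a (Suc n)) = 0" for n
    proof (rule dirichlet_coeffs_zero[where f = "\<lambda>n. E n - of_real (a n)" and \<sigma> = 2])
      show "summable (\<lambda>n. cmod (E (Suc n) - of_real (a (Suc n))) * real (Suc n) powr - 2)"
      proof (rule summable_comparison_test'[OF summable_add[OF E_summable sum_a[of 2]], of 0])
        fix n
        have "a (Suc n) \<ge> 0" using b0[of "Suc n"] by (simp add: a_def)
        then have "cmod (E (Suc n) - of_real (a (Suc n))) \<le> cmod (E (Suc n)) + a (Suc n)"
          using norm_triangle_ineq4[of "E (Suc n)" "of_real (a (Suc n))"] by simp
        from mult_right_mono[OF this, of "real (Suc n) powr - 2"]
        show "norm (cmod (E (Suc n) - of_real (a (Suc n))) * real (Suc n) powr - 2)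
          \<le> cmod (E (Suc n)) * real (Suc n) powr - 2 + a (Suc n) * real (Suc n) powr - 2"
          by (simp add: distrib_right)
      qed simp
    next
      fix s :: real assume s: "s \<ge> 2"
      have "summable (\<lambda>n. cmod (E (Suc n)) * real (Suc n) powr - s)"
      proof (rule summable_comparison_test'[OF E_summable, of 0])
        fix n
        have "real (Suc n) powr - s \<le> real (Suc n) powr - 2" using s by (intro powr_mono) auto
        then show "norm (cmod (E (Suc n)) * real (Suc n) powr - s)
          \<le> cmod (E (Suc n)) * real (Suc n) powr - 2" by (simp add: mult_left_mono)
      qed
      then have "summable (\<lambda>n. cmod (E (Suc n) * of_real (real (Suc n) powr - s)))"
        by (simp add: norm_mult)
      then have sE: "summable (\<lambda>n. E (Suc n) * of_real (real (Suc n) powr - s))"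
        by (rule summable_norm_cancel)
      have sa: "summable (\<lambda>n. complex_of_real (a (Suc n) * real (Suc n) powr - s))"
        using sum_a s by (subst summable_of_real_iff) auto
      have "(\<Sum>n. E (Suc n) * of_real (real (Suc n) powr - s)) = dirichlet_eval E (of_real s)"
        by (simp only: dirichlet_eval_real)
      also have "\<dots> = eval_fps ?\<phi> (dirichlet_eval ?D (of_real s))" using s by (subst eval) auto
      also have "\<dots> = (\<Sum>n. of_real (a (Suc n) * real (Suc n) powr - s))"
        unfolding a_def using s by (intro series) (auto simp: c_def)
      finally show "(\<Sum>n. (E (Suc n) - of_real (a (Suc n))) * of_real (real (Suc n) powr - s)) = 0"
        using suminf_diff[OF sE sa] by (simp add: left_diff_distrib)
    qed
    then have "E (Suc n) = of_real (a (Suc n))" for n by simp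
    with E \<epsilon> have "summable (\<lambda>n. (a (Suc n))\<^sup>2 * real (Suc n) powr (- 2 * \<epsilon>))"
      by (auto simp: H_plus_def)
    \<comment> \<open>The factor n^(-1/2) comes from \<open>?D\<close> and n^(-\<epsilon>) from the
      weight in \<open>H_plus\<close> at \<sigma> = \<epsilon>; together they form the factor of the
      series excluded from \<open>H2\<close>.\<close>
    moreover have "(a n)\<^sup>2 * real n powr (- 2 * \<epsilon>)
        = (cmod (complex_of_real (b n * (1 / real n powr (1 / 2 + \<epsilon>)))))\<^sup>2" for n
    proof -
      have "real n powr (- 2 * \<epsilon>) = (real n powr - \<epsilon>)\<^sup>2"
        by (simp add: power2_eq_square flip: powr_add)
      moreover have "real n powr - (1 / 2) * real n powr - \<epsilon> = 1 / real n powr (1 / 2 + \<epsilon>)"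
        by (simp add: powr_minus_divide[symmetric] flip: powr_add)
      ultimately show ?thesis
        by (simp only: a_def norm_of_real power2_abs mult.assoc flip: power_mult_distrib)
    qed
    ultimately have "(\<lambda>n. complex_of_real (b n * (1 / real n powr (1 / 2 + \<epsilon>)))) \<in> H2"
      by (simp only: H2_def mem_Collect_eq)
    with not_H2 show False by contradiction
  qed
  then show ?thesis
    using not_H2 \<epsilon>(1) unfolding b_def c_def by blast
qed

end
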